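(* Consider the Feedback MAB problem and the linear program (Whittle) defined in the context. The gap of (Whittle) is arbitrarily close to $e/(e-1)$: for every $\eta>0$ there is an instance of Feedback MAB for which the optimal value of (Whittle) is at least $\bigl(\frac{e}{e-1}-\eta\bigr)$ times the value of an optimal policy.
   Context: Feedback MAB: $n$ arms; arm $i$ has states $g_i$ (good) and $b_i$ (bad) and reward $r_i$; its state evolves as a two-state Markov chain, independently of other arms and of plays, with $\Pr[b_i\to g_i]=\alpha_i$, $\Pr[g_i\to b_i]=\beta_i$ per step, $\alpha_i+\beta_i\le1-\delta$ for a given $\delta>0$. At each step at most one arm is played; playing arm $i$ yields $r_i$ if it is in $g_i$ (else $0$) and reveals its current state; unplayed arms are unobserved. The value of a policy is its infinite-horizon time-average expected reward. Let $v_{it}=\frac{\alpha_i}{\alpha_i+\beta_i}(1-(1-\alpha_i-\beta_i)^t)$ and $u_{it}=\frac{\alpha_i}{\alpha_i+\beta_i}+\frac{\beta_i}{\alpha_i+\beta_i}(1-\alpha_i-\beta_i)^t$. The LP (Whittle) has variables $x^i_{st}\ge0$ for each arm $i$, $s\in\{g,b\}$, integer $t\ge1$, and is: maximize $\sum_{i}\sum_{t\ge1} r_i x^i_{gt}$ subject to $\sum_i\sum_{s\in\{g,b\}}\sum_{t\ge1}x^i_{st}=1$; $\sum_{t\ge1}\sum_{s\in\{g,b\}} t\,x^i_{st}\le1$ for all $i$; $\sum_{t\ge1}x^i_{bt}v_{it}=\sum_{t\ge1}x^i_{gt}(1-u_{it})$ for all $i$. *)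

theory Defs
  imports "HOL-Probability.Probability"
begin

datatype arm_state = Good | Bad

record mab =
  num_arms :: nat
  to_good :: "nat \<Rightarrow> real"
  to_bad :: "nat \<Rightarrow> real"
  reward :: "nat \<Rightarrow> real"

definition feedback_mab :: "real \<Rightarrow> mab \<Rightarrow> bool" where
  "feedback_mab \<delta> I \<longleftrightarrow> num_arms I \<ge> 1 \<and>
     (\<forall>i<num_arms I. 0 < to_good I i \<and> 0 < to_bad I i \<and>
        to_good I i + to_bad I i \<le> 1 - \<delta> \<and> 0 \<le> reward I i)"

definition arm_step :: "mab \<Rightarrow> nat \<Rightarrow> arm_state \<Rightarrow> arm_state pmf" where
  "arm_step I i s = (case s of
     Bad \<Rightarrow> map_pmf (\<lambda>c. if c then Good else Bad) (bernoulli_pmf (to_good I i))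
   | Good \<Rightarrow> map_pmf (\<lambda>c. if c then Bad else Good) (bernoulli_pmf (to_bad I i)))"

text \<open>
  A history lists the past steps, most recent first: None if no arm was played, and
  Some (i, s) if arm i was played and found in state s. A policy maps the history to a
  (possibly randomized) choice of at most one arm; it has no other access to the states.
\<close>

type_synonym history = "(nat \<times> arm_state) option list"
type_synonym policy = "history \<Rightarrow> nat option pmf"

definition policies :: "mab \<Rightarrow> policy set" where
  "policies I = {\<pi>. \<forall>h. set_pmf (\<pi> h) \<subseteq> insert None (Some ` {..<num_arms I})}"

definition observe :: "(nat \<Rightarrow> arm_state) \<Rightarrow> nat option \<Rightarrow> (nat \<times> arm_state) option" where
  "observe \<sigma> a = map_option (\<lambda>i. (i, \<sigma> i)) a"

definition step_reward :: "mab \<Rightarrow> (nat \<Rightarrow> arm_state) \<Rightarrow> nat option \<Rightarrow> real" where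
  "step_reward I \<sigma> a =
     (case a of None \<Rightarrow> 0 | Some i \<Rightarrow> if \<sigma> i = Good then reward I i else 0)"

text \<open>
  Joint law of the arm states at time t and of the history before time t, when the arms start
  independently with laws given by init. The play at time t is rewarded and observed in the
  current state; afterwards every arm, played or not, makes one transition.
\<close>

primrec process ::
  "mab \<Rightarrow> (nat \<Rightarrow> arm_state pmf) \<Rightarrow> policy \<Rightarrow> nat \<Rightarrow> ((nat \<Rightarrow> arm_state) \<times> history) pmf" where
  "process I init \<pi> 0 = map_pmf (\<lambda>\<sigma>. (\<sigma>, [])) (Pi_pmf {..<num_arms I} Bad init)"
| "process I init \<pi> (Suc t) =
     bind_pmf (process I init \<pi> t) (\<lambda>(\<sigma>, h).
     bind_pmf (\<pi> h) (\<lambda>a.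
     map_pmf (\<lambda>\<sigma>'. (\<sigma>', observe \<sigma> a # h))
       (Pi_pmf {..<num_arms I} Bad (\<lambda>i. arm_step I i (\<sigma> i)))))"

definition expected_reward ::
  "mab \<Rightarrow> (nat \<Rightarrow> arm_state pmf) \<Rightarrow> policy \<Rightarrow> nat \<Rightarrow> real" where
  "expected_reward I init \<pi> t =
     measure_pmf.expectation
       (bind_pmf (process I init \<pi> t) (\<lambda>(\<sigma>, h). map_pmf (step_reward I \<sigma>) (\<pi> h)))
       (\<lambda>r. r)"

text \<open>
  The time averages of an arbitrary policy need not converge; the limit superior gives every
  policy its most favourable value, so the optimum is at least the one defined with the limit
  inferior, and upper bounds on it are the stronger ones.
\<close>

definition policy_value :: "mab \<Rightarrow> (nat \<Rightarrow> arm_state pmf) \<Rightarrow> policy \<Rightarrow> ereal" where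
  "policy_value I init \<pi> =
     limsup (\<lambda>T. ereal ((\<Sum>t<T. expected_reward I init \<pi> t) / real T))"

definition optimal_value :: "mab \<Rightarrow> (nat \<Rightarrow> arm_state pmf) \<Rightarrow> ereal" where
  "optimal_value I init = (SUP \<pi>\<in>policies I. policy_value I init \<pi>)"

definition v :: "mab \<Rightarrow> nat \<Rightarrow> nat \<Rightarrow> real" where
  "v I i t = to_good I i / (to_good I i + to_bad I i) * (1 - (1 - to_good I i - to_bad I i) ^ t)"

definition u :: "mab \<Rightarrow> nat \<Rightarrow> nat \<Rightarrow> real" where
  "u I i t = to_good I i / (to_good I i + to_bad I i)
     + to_bad I i / (to_good I i + to_bad I i) * (1 - to_good I i - to_bad I i) ^ t"

text \<open>
  An unordered sum that diverges is 0 in the library, so convergence of the second family of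
  constraints is required explicitly; all other series in the program then converge by
  comparison.
\<close>

definition whittle_feasible :: "mab \<Rightarrow> (nat \<Rightarrow> arm_state \<Rightarrow> nat \<Rightarrow> real) \<Rightarrow> bool" where
  "whittle_feasible I x \<longleftrightarrow>
     (\<forall>i<num_arms I. \<forall>s. \<forall>t\<ge>1. 0 \<le> x i s t) \<and>
     (\<forall>i<num_arms I. \<forall>s. (\<lambda>t. real t * x i s t) summable_on {1..}) \<and>
     (\<Sum>i<num_arms I. \<Sum>s\<in>{Good, Bad}. \<Sum>\<^sub>\<infinity>t\<in>{1..}. x i s t) = 1 \<and>
     (\<forall>i<num_arms I. (\<Sum>\<^sub>\<infinity>t\<in>{1..}. \<Sum>s\<in>{Good, Bad}. real t * x i s t) \<le> 1) \<and>
     (\<forall>i<num_arms I. (\<Sum>\<^sub>\<infinity>t\<in>{1..}. x i Bad t * v I i t)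
        = (\<Sum>\<^sub>\<infinity>t\<in>{1..}. x i Good t * (1 - u I i t)))"

definition whittle_objective :: "mab \<Rightarrow> (nat \<Rightarrow> arm_state \<Rightarrow> nat \<Rightarrow> real) \<Rightarrow> real" where
  "whittle_objective I x = (\<Sum>i<num_arms I. \<Sum>\<^sub>\<infinity>t\<in>{1..}. reward I i * x i Good t)"

definition whittle_value :: "mab \<Rightarrow> ereal" where
  "whittle_value I = (SUP x\<in>{x. whittle_feasible I x}. ereal (whittle_objective I x))"

end

theory Submission
  imports Defs
begin

text \<open>
  Take n identical arms of reward 1 whose stationary probability of being good is 1/n. Plays do
  not influence the arms, so no policy can earn more per step than the probability that some arm
  is good, which tends to 1 - (1 - 1/n)^n. The linear program only sees the expected number of
  good arms, which is 1. When the chains mix slowly, with transition probabilities a to good and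
  b to bad such that a + b = 1/n^3, it can keep playing a
  good arm and wait n^2 steps after a bad observation; the probability of finding the arm good is
  then of order 1/n^2, far above the probability b < 1/n^3 of losing it, so nearly all plays
  succeed and the optimum is at least 1 - 2/n. The ratio tends to 1 / (1 - 1/e).
\<close>

subsection \<open>Laws of the arm states\<close>

primrec state_law :: "mab \<Rightarrow> (nat \<Rightarrow> arm_state pmf) \<Rightarrow> nat \<Rightarrow> nat \<Rightarrow> arm_state pmf" where
  "state_law I init 0 i = init i"
| "state_law I init (Suc t) i = bind_pmf (state_law I init t i) (arm_step I i)"

text \<open>Plays reveal states without changing them, so after forgetting the history no trace of
  the policy remains. Each arm moves according to its own state alone, so the joint law stays a
  product; \<open>Pi_pmf_bind\<close> carries this through the induction.\<close>

lemma map_fst_process: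
  "map_pmf fst (process I init \<pi> t) = Pi_pmf {..<num_arms I} Bad (state_law I init t)"
proof (induction t)
  case 0
  show ?case by (simp add: map_pmf_comp)
next
  case (Suc t)
  have "map_pmf fst (process I init \<pi> (Suc t)) =
      bind_pmf (process I init \<pi> t)
        (\<lambda>x. Pi_pmf {..<num_arms I} Bad (\<lambda>i. arm_step I i (fst x i)))"
    by (simp add: map_bind_pmf map_pmf_comp case_prod_unfold)
  also have "\<dots> = bind_pmf (map_pmf fst (process I init \<pi> t))
        (\<lambda>\<sigma>. Pi_pmf {..<num_arms I} Bad (\<lambda>i. arm_step I i (\<sigma> i)))"
    by (simp add: bind_map_pmf)
  also have "\<dots> = Pi_pmf {..<num_arms I} Bad (state_law I init (Suc t))"
    unfolding Suc.IH state_law.simps(2)[abs_def] by (simp add: Pi_pmf_bind[where d' = Bad])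
  finally show ?case .
qed

lemma expectation_arm_state:
  fixes f :: "arm_state \<Rightarrow> real"
  shows "measure_pmf.expectation p f = f Good * pmf p Good + f Bad * pmf p Bad"
proof -
  have "s \<in> {Good, Bad}" for s
    by (cases s) auto
  then show ?thesis
    using integral_measure_pmf_real[of "{Good, Bad}" p f] by simp
qed

lemma pmf_Bad_eq: "pmf p Bad = 1 - pmf p Good"
  using expectation_arm_state[of p "\<lambda>_. 1"] by simp

lemma pmf_arm_step_Good:
  assumes "feedback_mab \<delta> I" "0 < \<delta>" "i < num_arms I"
  shows "pmf (arm_step I i s) Good = (if s = Good then 1 - to_bad I i else to_good I i)"
proof -
  have *: "0 < to_good I i" "to_good I i \<le> 1" "0 < to_bad I i" "to_bad I i \<le> 1"
    using assms by (force simp: feedback_mab_def)+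
  have "(\<lambda>c. if c then Good else Bad) -` {Good} = {True}"
    "(\<lambda>c. if c then Bad else Good) -` {Good} = {False}"
    by (auto split: if_splits)
  then show ?thesis
    using * by (cases s) (simp_all add: arm_step_def pmf_map measure_pmf_single)
qed

text \<open>\<open>p\<close> is the stationary probability of being good. The deviation from it is
  multiplied at every step by the second eigenvalue of the transition matrix, 1 -
  \<open>to_good\<close> - \<open>to_bad\<close>.\<close>

lemma pmf_state_law_Good:
  assumes "feedback_mab \<delta> I" "0 < \<delta>" "i < num_arms I"
  defines "p \<equiv> to_good I i / (to_good I i + to_bad I i)"
  shows "pmf (state_law I init t i) Good - p =
    (1 - to_good I i - to_bad I i) ^ t * (pmf (init i) Good - p)"
proof (induction t)
  case 0
  show ?case by simp
next
  case (Suc t)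
  have pos: "0 < to_good I i + to_bad I i"
    using assms by (force simp: feedback_mab_def)
  let ?q = "pmf (state_law I init t i) Good"
  have p: "p * (to_good I i + to_bad I i) = to_good I i"
    using pos by (simp add: p_def)
  have "pmf (state_law I init (Suc t) i) Good =
      (1 - to_bad I i) * ?q + to_good I i * (1 - ?q)"
    using pmf_arm_step_Good[OF assms(1-3)]
    by (simp add: pmf_bind expectation_arm_state pmf_Bad_eq)
  also have "\<dots> - p = (1 - to_good I i - to_bad I i) * (?q - p)"
    using p by (simp add: algebra_simps)
  finally show ?case using Suc.IH by simp
qed

subsection \<open>Bounds on the value of a policy\<close>

text \<open>However cleverly the history is used, a single play earns at most 1, and nothing when
  all arms are bad. By independence all arms are bad with the probability given by the
  product.\<close>

lemma expected_reward_le_prob_some_good: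
  assumes "\<And>i. i < num_arms I \<Longrightarrow> 0 \<le> reward I i \<and> reward I i \<le> 1" and "\<pi> \<in> policies I"
  shows "expected_reward I init \<pi> t
    \<le> 1 - (\<Prod>i<num_arms I. 1 - pmf (state_law I init t i) Good)"
proof -
  \<comment> \<open>Joint law of the states and the chosen action, with the history
    forgotten.\<close>
  define J where "J = bind_pmf (process I init \<pi> t) (\<lambda>(\<sigma>, h). map_pmf (\<lambda>a. (\<sigma>, a)) (\<pi> h))"
  let ?L = "Pi_pmf {..<num_arms I} Bad (state_law I init t)"
  \<comment> \<open>Indices outside the arm range carry the default \<open>Bad\<close>, so "no arm
    is good" is the single point \<open>\<lambda>_. Bad\<close>.\<close>
  let ?S = "UNIV - {\<lambda>_. Bad} :: (nat \<Rightarrow> arm_state) set"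
  have J1: "map_pmf fst J = ?L"
    unfolding J_def map_fst_process[of I init \<pi> t, symmetric]
    by (simp add: map_pmf_def bind_assoc_pmf bind_return_pmf case_prod_unfold)
  have supp: "snd x \<in> insert None (Some ` {..<num_arms I})" if "x \<in> set_pmf J" for x
    using that assms(2) unfolding J_def policies_def by force
  have bounds: "0 \<le> step_reward I (fst x) (snd x) \<and>
      step_reward I (fst x) (snd x) \<le> indicator ?S (fst x)" if "x \<in> set_pmf J" for x
    using supp[OF that] assms(1) by (auto simp: step_reward_def indicator_def)
  have "expected_reward I init \<pi> t = measure_pmf.expectation J (\<lambda>x. step_reward I (fst x) (snd x))"
  proof -
    have "bind_pmf (process I init \<pi> t) (\<lambda>(\<sigma>, h). map_pmf (step_reward I \<sigma>) (\<pi> h)) =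
        map_pmf (\<lambda>x. step_reward I (fst x) (snd x)) J"
      by (simp add: J_def map_bind_pmf case_prod_unfold map_pmf_comp)
    then show ?thesis by (simp add: expected_reward_def)
  qed
  also have "\<dots> \<le> measure_pmf.expectation J (\<lambda>x. indicator ?S (fst x))"
  proof (rule integral_mono_AE)
    have "norm (step_reward I (fst x) (snd x)) \<le> 1" if "x \<in> set_pmf J" for x
      using bounds[OF that] order_trans[OF _ indicator_le_1] by auto
    then show "integrable J (\<lambda>x. step_reward I (fst x) (snd x))"
      by (intro measure_pmf.integrable_const_bound[where B = 1]) (auto simp: AE_measure_pmf_iff)
    show "integrable J (\<lambda>x. indicator ?S (fst x) :: real)"
      by (intro measure_pmf.integrable_const_bound[where B = 1]) (auto simp: indicator_def)
  qed (use bounds in \<open>auto simp: AE_measure_pmf_iff\<close>)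
  also have "\<dots> = measure_pmf.expectation (map_pmf fst J) (indicator ?S)"
    by (rule integral_map_pmf[symmetric])
  also have "\<dots> = 1 - pmf ?L (\<lambda>_. Bad)"
    unfolding J1 by (simp add: measure_pmf.prob_compl[of "{\<lambda>_. Bad}", simplified] measure_pmf_single)
  also have "\<dots> = 1 - (\<Prod>i<num_arms I. 1 - pmf (state_law I init t i) Good)"
    by (simp add: pmf_Pi' pmf_Bad_eq)
  finally show ?thesis .
qed

lemma expected_reward_constant_policy:
  assumes "i < num_arms I"
  shows "expected_reward I init (\<lambda>_. return_pmf (Some i)) t =
    reward I i * pmf (state_law I init t i) Good"
proof -
  let ?P = "process I init (\<lambda>_. return_pmf (Some i)) t"
  have "expected_reward I init (\<lambda>_. return_pmf (Some i)) t =
      measure_pmf.expectation ?P (\<lambda>x. if fst x i = Good then reward I i else 0)"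
    by (simp add: expected_reward_def case_prod_unfold step_reward_def flip: map_pmf_def)
  also have "\<dots> = measure_pmf.expectation (map_pmf (\<lambda>\<sigma>. \<sigma> i) (map_pmf fst ?P))
      (\<lambda>s. if s = Good then reward I i else 0)"
    by (simp add: map_pmf_comp)
  also have "map_pmf (\<lambda>\<sigma>. \<sigma> i) (map_pmf fst ?P) = state_law I init t i"
    unfolding map_fst_process using assms by (simp add: Pi_pmf_component)
  also have "measure_pmf.expectation \<dots> (\<lambda>s. if s = Good then reward I i else 0) =
      reward I i * pmf (state_law I init t i) Good"
    by (simp add: expectation_arm_state)
  finally show ?thesis .
qed

lemma sum_power_le:
  fixes q :: real
  assumes "0 \<le> q" "q < 1"
  shows "(\<Sum>t<T. q ^ t) \<le> 1 / (1 - q)"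
  using assms by (simp add: sum_gp_strict divide_right_mono)

lemma average_of_linear_tendsto:
  fixes L C :: real
  shows "(\<lambda>T. (real T * L + C) / real T) \<longlonglongrightarrow> L"
proof -
  have "(\<lambda>T. L + C / real T) \<longlonglongrightarrow> L + 0"
    by (intro tendsto_intros lim_const_over_n)
  moreover have "eventually (\<lambda>T. L + C / real T = (real T * L + C) / real T) sequentially"
    using eventually_gt_at_top[of 0] by eventually_elim (simp add: field_simps)
  ultimately show ?thesis by (simp add: tendsto_cong)
qed

text \<open>The initial laws are arbitrary, so bounds at time t hold only up to a geometrically
  decaying error. Its sum stays below C / (1 - q) and vanishes in the time average.\<close>

lemma policy_value_le:
  assumes "\<And>t. expected_reward I init \<pi> t \<le> L + C * q ^ t" "0 \<le> q" "q < 1" "0 \<le> C"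
  shows "policy_value I init \<pi> \<le> ereal L"
proof -
  have *: "(\<Sum>t<T. expected_reward I init \<pi> t) \<le> real T * L + C / (1 - q)" for T
  proof -
    have "(\<Sum>t<T. expected_reward I init \<pi> t) \<le> (\<Sum>t<T. L + C * q ^ t)"
      by (intro sum_mono assms)
    also have "\<dots> = real T * L + C * (\<Sum>t<T. q ^ t)"
      by (simp add: sum.distrib sum_distrib_left)
    also have "\<dots> \<le> real T * L + C * (1 / (1 - q))"
      using assms by (intro add_left_mono mult_left_mono sum_power_le)
    finally show ?thesis by simp
  qed
  have "policy_value I init \<pi> \<le> limsup (\<lambda>T. ereal ((real T * L + C / (1 - q)) / real T))"
    unfolding policy_value_def
    by (intro Limsup_mono always_eventually allI) (simp add: divide_right_mono *)
  also have "\<dots> = ereal L"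
    by (intro lim_imp_Limsup tendsto_ereal average_of_linear_tendsto) simp
  finally show ?thesis .
qed

lemma policy_value_ge:
  assumes "\<And>t. expected_reward I init \<pi> t \<ge> L - C * q ^ t" "0 \<le> q" "q < 1" "0 \<le> C"
  shows "policy_value I init \<pi> \<ge> ereal L"
proof -
  have *: "(\<Sum>t<T. expected_reward I init \<pi> t) \<ge> real T * L + - (C / (1 - q))" for T
  proof -
    have "real T * L - C * (1 / (1 - q)) \<le> real T * L - C * (\<Sum>t<T. q ^ t)"
      using assms by (intro diff_left_mono mult_left_mono sum_power_le)
    also have "\<dots> = (\<Sum>t<T. L - C * q ^ t)"
      by (simp add: sum_subtractf sum_distrib_left)
    also have "\<dots> \<le> (\<Sum>t<T. expected_reward I init \<pi> t)"
      by (intro sum_mono assms)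
    finally show ?thesis by simp
  qed
  have "ereal L = limsup (\<lambda>T. ereal ((real T * L + - (C / (1 - q))) / real T))"
    by (intro lim_imp_Limsup[symmetric] tendsto_ereal average_of_linear_tendsto) simp
  also have "\<dots> \<le> policy_value I init \<pi>"
    unfolding policy_value_def
    by (intro Limsup_mono always_eventually allI) (simp only: ereal_less_eq divide_right_mono * of_nat_0_le_iff)
  finally show ?thesis .
qed

subsection \<open>Identical arms\<close>

text \<open>The parameter \<open>l\<close> is the sum of both transition probabilities. It sets the
  mixing speed and leaves the stationary probability of being good at 1/n.\<close>

definition identical_arms :: "nat \<Rightarrow> real \<Rightarrow> mab" where
  "identical_arms n l = \<lparr>num_arms = n, to_good = (\<lambda>_. l / real n),
     to_bad = (\<lambda>_. l * (1 - 1 / real n)), reward = (\<lambda>_. 1)\<rparr>"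

lemma identical_arms_simps [simp]:
  "num_arms (identical_arms n l) = n"
  "to_good (identical_arms n l) i = l / real n"
  "to_bad (identical_arms n l) i = l * (1 - 1 / real n)"
  "reward (identical_arms n l) i = 1"
  by (simp_all add: identical_arms_def)

lemma to_good_add_to_bad_identical_arms: "l / real n + l * (1 - 1 / real n) = l"
  by (simp add: algebra_simps)

lemma feedback_mab_identical_arms:
  assumes "2 \<le> n" "0 < l" "l \<le> 1 - \<delta>"
  shows "feedback_mab \<delta> (identical_arms n l)"
  using assms to_good_add_to_bad_identical_arms[of l n] by (simp add: feedback_mab_def)

lemma state_law_identical_arms:
  assumes "2 \<le> n" "0 < l" "l < 1" "i < n"
  shows "\<bar>pmf (state_law (identical_arms n l) init t i) Good - 1 / real n\<bar> \<le> (1 - l) ^ t"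
proof -
  \<comment> \<open>The largest separation parameter compatible with transition probabilities that
    sum to l.\<close>
  have "feedback_mab (1 - l) (identical_arms n l)"
    using assms by (intro feedback_mab_identical_arms) auto
  from pmf_state_law_Good[OF this, of i init t]
  have "pmf (state_law (identical_arms n l) init t i) Good - 1 / real n =
      (1 - l) ^ t * (pmf (init i) Good - 1 / real n)"
    using assms to_good_add_to_bad_identical_arms[of l n]
    by (simp add: diff_diff_eq)
  moreover have n: "0 \<le> 1 / real n" "1 / real n \<le> 1" using assms by auto
  have "\<bar>pmf (init i) Good - 1 / real n\<bar> \<le> 1"
    using n pmf_le_1[of "init i" Good] pmf_nonneg[of "init i" Good] by linarith
  ultimately show ?thesis
    using assms mult_left_le[of "\<bar>pmf (init i) Good - 1 / real n\<bar>" "(1 - l) ^ t"]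
    by (simp add: abs_mult)
qed

lemma optimal_value_identical_arms_le:
  assumes "2 \<le> n" "0 < l" "l < 1"
  shows "optimal_value (identical_arms n l) init \<le> ereal (1 - (1 - 1 / real n) ^ n)"
  unfolding optimal_value_def
proof (rule SUP_least)
  let ?I = "identical_arms n l"
  fix \<pi> assume \<pi>: "\<pi> \<in> policies ?I"
  have "expected_reward ?I init \<pi> t \<le> (1 - (1 - 1 / real n) ^ n) + real n * (1 - l) ^ t" for t
  proof -
    let ?p = "\<lambda>i. pmf (state_law ?I init t i) Good"
    \<comment> \<open>Products of numbers in [0, 1] differ by at most the sum of the differences of
      their factors.\<close>
    have "\<bar>(\<Prod>i<n. 1 - ?p i) - (\<Prod>i<n. 1 - 1 / real n)\<bar> \<le> (\<Sum>i<n. \<bar>(1 - ?p i) - (1 - 1 / real n)\<bar>)"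
      using norm_prod_diff[of "{..<n}" "\<lambda>i. 1 - ?p i" "\<lambda>i. 1 - 1 / real n"] assms
      by (simp add: pmf_le_1)
    also have "\<dots> \<le> (\<Sum>i<n. (1 - l) ^ t)"
      using state_law_identical_arms[OF assms, of _ init t]
      by (intro sum_mono) (simp add: abs_minus_commute)
    finally have "(\<Prod>i<n. 1 - ?p i) \<ge> (1 - 1 / real n) ^ n - real n * (1 - l) ^ t"
      by (simp add: abs_le_iff)
    then show ?thesis
      using expected_reward_le_prob_some_good[OF _ \<pi>, of init t] by simp
  qed
  then show "policy_value ?I init \<pi> \<le> ereal (1 - (1 - 1 / real n) ^ n)"
    by (rule policy_value_le) (use assms in auto)
qed

text \<open>Always playing arm 0 earns 1/n in the long run. This makes the optimum positive, so that
  comparing it with the program by a ratio is meaningful.\<close>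

lemma optimal_value_identical_arms_ge:
  assumes "2 \<le> n" "0 < l" "l < 1"
  shows "ereal (1 / real n) \<le> optimal_value (identical_arms n l) init"
proof -
  let ?I = "identical_arms n l" and ?\<pi> = "\<lambda>_ :: history. return_pmf (Some 0) :: nat option pmf"
  have "expected_reward ?I init ?\<pi> t \<ge> 1 / real n - 1 * (1 - l) ^ t" for t
    using expected_reward_constant_policy[of 0 ?I init t] assms
      state_law_identical_arms[OF assms, of 0 init t]
    by (simp add: abs_le_iff)
  then have "ereal (1 / real n) \<le> policy_value ?I init ?\<pi>"
    by (rule policy_value_ge) (use assms in auto)
  also have "\<dots> \<le> optimal_value ?I init"
    unfolding optimal_value_def
    by (rule SUP_upper) (use assms in \<open>auto simp: policies_def\<close>)
  finally show ?thesis .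
qed

subsection \<open>The linear program\<close>

lemma has_sum_single:
  assumes "k \<in> S" "\<And>t. t \<in> S \<Longrightarrow> t \<noteq> k \<Longrightarrow> f t = 0"
  shows "(f has_sum f k) S"
  using assms by (intro has_sum_finite_neutralI[of "{k}"]) auto

text \<open>Second-order Bonferroni bound: the binomial expansion is cut after its quadratic term.
  The induction keeps the exact coefficient t(t - 1)/2, which is enlarged to t^2/2 only at the
  end.\<close>

lemma one_minus_power_le:
  fixes x :: real
  assumes "0 \<le> x" "x \<le> 1"
  shows "(1 - x) ^ t \<le> 1 - real t * x + (real t * x)\<^sup>2 / 2"
proof -
  have "(1 - x) ^ t \<le> 1 - real t * x + real t * (real t - 1) * x\<^sup>2 / 2"
  proof (induction t)
    case (Suc t)
    have "(1 - x) ^ Suc t \<le> (1 - x) * (1 - real t * x + real t * (real t - 1) * x\<^sup>2 / 2)"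
      using assms Suc by (simp add: mult_left_mono)
    also have "\<dots> = 1 - real (Suc t) * x + real (Suc t) * (real (Suc t) - 1) * x\<^sup>2 / 2
        - x * (real t * (real t - 1) * x\<^sup>2 / 2)"
      by (simp add: field_simps power2_eq_square)
    also have "\<dots> \<le> 1 - real (Suc t) * x + real (Suc t) * (real (Suc t) - 1) * x\<^sup>2 / 2"
    proof -
      have "0 \<le> real t * (real t - 1)"
        by (cases t) auto
      then have "0 \<le> x * (real t * (real t - 1) * x\<^sup>2 / 2)"
        using assms by (intro mult_nonneg_nonneg[of x] divide_nonneg_nonneg mult_nonneg_nonneg[of _ "x\<^sup>2"]) simp_all
      then show ?thesis by simp
    qed
    finally show ?case .
  qed simp
  also have "real t * (real t - 1) * x\<^sup>2 / 2 \<le> (real t * x)\<^sup>2 / 2"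
    using assms by (simp add: algebra_simps power2_eq_square)
  finally show ?thesis by simp
qed

text \<open>
  The solution plays a good arm again at once and a bad arm after N steps, in the proportion
  forced by the balance constraint.
\<close>

lemma whittle_value_identical_arms_ge:
  fixes n N :: nat and l :: real
  assumes "2 \<le> n" "0 < l" "l < 1" "1 \<le> N" and wait: "real N * l \<le> 1 - (1 - l) ^ N + real n * l"
  defines "w \<equiv> (1 - (1 - l) ^ N) / real n" and "b \<equiv> l * (1 - 1 / real n)"
  shows "ereal (w / (w + b)) \<le> whittle_value (identical_arms n l)"
proof -
  let ?I = "identical_arms n l"
  \<comment> \<open>Balance requires B w = A b and the total mass requires n (A + B) = 1. These two
    equations determine A and B, and the objective becomes n A = w / (w + b).\<close>
  define A where "A = w / (w + b) / real n"
  define B where "B = b / (w + b) / real n"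
  define x :: "nat \<Rightarrow> arm_state \<Rightarrow> nat \<Rightarrow> real" where
    "x = (\<lambda>i s t. case s of Good \<Rightarrow> (if t = 1 then A else 0) | Bad \<Rightarrow> (if t = N then B else 0))"
  have n: "real n > 0" using assms by simp
  have b: "b > 0" using assms by (simp add: b_def)
  have "(1 - l) ^ N < 1" using assms by (simp add: power_less_one_iff)
  then have w: "w > 0" using n by (simp add: w_def)
  have "A + B = (w + b) / (w + b) / real n"
    unfolding A_def B_def by (simp only: add_divide_distrib)
  then have AB: "A \<ge> 0" "B \<ge> 0" "A + B = 1 / real n" "B * w = A * b"
    using w b n by (simp_all add: A_def B_def)
  have v: "v ?I i N = w" for i
    using assms to_good_add_to_bad_identical_arms[of l n] by (simp add: v_def w_def diff_diff_eq)
  have u: "1 - u ?I i 1 = b" for i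
    using assms to_good_add_to_bad_identical_arms[of l n]
    by (simp add: u_def b_def diff_diff_eq) (simp add: field_simps)
  \<comment> \<open>The free weight f is later taken to be 1, t, \<open>v\<close> or 1 -
    \<open>u\<close>, so that \<open>sumG\<close> and \<open>sumB\<close> evaluate every series of
    the program.\<close>
  have sumG: "((\<lambda>t. f t * x i Good t) has_sum f 1 * A) {1..}" for i and f :: "nat \<Rightarrow> real"
    using has_sum_single[of 1 "{1..}" "\<lambda>t. f t * x i Good t"] by (simp add: x_def)
  have sumB: "((\<lambda>t. f t * x i Bad t) has_sum f N * B) {1..}" for i and f :: "nat \<Rightarrow> real"
    using has_sum_single[of N "{1..}" "\<lambda>t. f t * x i Bad t"] assms by (simp add: x_def)
  \<comment> \<open>The time constraint of one arm. Multiplied by n^2 (w + b), it is (n - 1) times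
    the hypothesis \<open>wait\<close> after cancelling n w.\<close>
  have "A + real N * B \<le> 1"
  proof -
    have P: "real n * w = 1 - (1 - l) ^ N" and b': "real n * b = l * (real n - 1)"
      using n by (simp_all add: w_def b_def field_simps)
    have "(real n - 1) * (real N * l) \<le> (real n - 1) * (real n * w + real n * l)"
      using wait assms unfolding P by (intro mult_left_mono) auto
    then have "real n * w + real N * (real n * b) \<le> real n * (real n * w + real n * b)"
      unfolding b' by (simp add: algebra_simps)
    then have "real n * (w + real N * b) \<le> real n * (real n * (w + b))"
      by (simp add: algebra_simps)
    then have "w + real N * b \<le> real n * (w + b)"
      using n by simp
    moreover have "A + real N * B = (w + real N * b) / (real n * (w + b))"
      by (simp add: A_def B_def add_divide_distrib mult.commute)
    ultimately show ?thesis using w b n by (simp add: divide_le_eq_1)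
  qed
  then have "(\<Sum>\<^sub>\<infinity>t\<in>{1..}. \<Sum>s\<in>{Good, Bad}. real t * x i s t) \<le> 1" for i
    using infsumI[OF has_sum_add[OF sumG[of real i] sumB[of real i]]] by simp
  moreover have "(\<lambda>t. real t * x i s t) summable_on {1..}" for i s
    using sumG[of real i] sumB[of real i] by (cases s) (auto simp: summable_on_def)
  moreover have "(\<Sum>i<n. \<Sum>s\<in>{Good, Bad}. \<Sum>\<^sub>\<infinity>t\<in>{1..}. x i s t) = 1"
    using infsumI[OF sumG[of "\<lambda>_. 1"]] infsumI[OF sumB[of "\<lambda>_. 1"]] AB n by simp
  moreover have "(\<Sum>\<^sub>\<infinity>t\<in>{1..}. x i Bad t * v ?I i t) =
      (\<Sum>\<^sub>\<infinity>t\<in>{1..}. x i Good t * (1 - u ?I i t))" for i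
    using infsumI[OF sumB[of "v ?I i" i]] infsumI[OF sumG[of "\<lambda>t. 1 - u ?I i t" i]] AB(4) u v
    by (simp add: mult.commute)
  moreover have "0 \<le> x i s t" for i s t
    using AB by (simp add: x_def split: arm_state.split)
  ultimately have "whittle_feasible ?I x"
    by (simp add: whittle_feasible_def)
  moreover have "whittle_objective ?I x = w / (w + b)"
    using infsumI[OF sumG[of "\<lambda>_. 1"]] n by (simp add: whittle_objective_def A_def)
  ultimately show ?thesis
    unfolding whittle_value_def by (metis (mono_tags, lifting) SUP_upper mem_Collect_eq)
qed

lemma whittle_value_slow_arms_ge:
  assumes "2 \<le> n"
  shows "ereal (1 - 2 / real n) \<le> whittle_value (identical_arms n (1 / real n ^ 3))"
proof -
  define l where "l = 1 / real n ^ 3"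
  define w where "w = (1 - (1 - l) ^ (n\<^sup>2)) / real n"
  define b where "b = l * (1 - 1 / real n)"
  have n: "real n \<ge> 2" using assms by simp
  have l: "0 < l" "l < 1" using n by (simp_all add: l_def one_less_power)
  have Nl: "real (n\<^sup>2) * l = 1 / real n"
    using n by (simp add: l_def power2_eq_square power3_eq_cube field_simps)
  have pow: "(1 - l) ^ (n\<^sup>2) \<le> 1 - 1 / real n + (1 / real n)\<^sup>2 / 2"
    using one_minus_power_le[of l "n\<^sup>2"] l unfolding Nl by simp
  have nl: "real n * l = (1 / real n)\<^sup>2"
    using n by (simp add: l_def power2_eq_square power3_eq_cube field_simps)
  \<comment> \<open>Waiting n^2 steps makes N l = 1/n. The quadratic error (1/n)^2 / 2 in
    \<open>pow\<close> is absorbed by the slack n l = (1/n)^2.\<close>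
  have "real (n\<^sup>2) * l \<le> 1 - (1 - l) ^ (n\<^sup>2) + real n * l"
    unfolding Nl nl using pow zero_le_power2[of "1 / real n"] by linarith
  then have *: "ereal (w / (w + b)) \<le> whittle_value (identical_arms n l)"
    unfolding w_def b_def using assms l by (intro whittle_value_identical_arms_ge) auto
  have b: "0 < b" "b \<le> l" using n l by (simp_all add: b_def field_simps)
  have "(1 / real n)\<^sup>2 \<le> 1 / real n"
    using n by (simp add: power2_eq_square field_simps)
  moreover have "x / 2 \<le> 1 - p" if "p \<le> 1 - x + x\<^sup>2 / 2" "x\<^sup>2 \<le> x" for x p :: real
    using that by linarith
  ultimately have "1 / real n / 2 \<le> 1 - (1 - l) ^ (n\<^sup>2)"
    using pow by blast
  then have w: "1 / real n / 2 / real n \<le> w"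
    unfolding w_def using n by (intro divide_right_mono) auto
  have "0 < 1 / real n / 2 / real n" using n by simp
  then have "0 < w" using w by linarith
  \<comment> \<open>The losing probability b is at most 1/n^3 and the recovery probability w at
    least 1/(2 n^2), so b / (w + b) is at most 2/n.\<close>
  have "b \<le> 2 / real n * (1 / real n / 2 / real n)"
    using b n by (simp add: l_def power3_eq_cube field_simps)
  also have "\<dots> \<le> 2 / real n * w"
    using w n by (intro mult_left_mono) auto
  finally have "b \<le> 2 / real n * (w + b)"
    using b n by (simp add: distrib_left add_increasing2)
  then have "1 - 2 / real n \<le> w / (w + b)"
    using b \<open>0 < w\<close> by (simp add: pos_le_divide_eq left_diff_distrib)
  with * show ?thesis unfolding l_def by (meson ereal_less_eq(3) order_trans)
qed

section \<open>Choice of the number of arms and comparison of the two values\<close>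

theorem theorem3:
  fixes \<delta> \<eta> :: real
  assumes "0 < \<delta>" and "\<delta> < 1" and "0 < \<eta>"
  shows "\<exists>I. feedback_mab \<delta> I \<and>
    (\<forall>init. 0 < optimal_value I init \<and>
       ereal (exp 1 / (exp 1 - 1) - \<eta>) * optimal_value I init \<le> whittle_value I)"
proof -
  \<comment> \<open>Truncation at 0 covers large \<eta> and makes multiplication by c
    monotone.\<close>
  define c where "c = max 0 (exp 1 / (exp 1 - 1) - \<eta>)"
  have c: "0 \<le> c" by (simp add: c_def)
  have e: "exp (1::real) > 1" by simp
  then have "c < exp 1 / (exp 1 - 1)"
    using assms by (simp add: c_def)
  \<comment> \<open>The limit 1 - 1/e of the upper bounds on the optimum is the reciprocal of e/(e -
    1). The strict inequality leaves room for the vanishing loss 2/n of the program.\<close>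
  then have "c * (1 - exp (- 1)) < 1"
    using e by (simp add: exp_minus field_simps)
  moreover have "(\<lambda>n. c * (1 - (1 - 1 / real n) ^ n) + 2 / real n) \<longlonglongrightarrow> c * (1 - exp (- 1)) + 0"
    using tendsto_exp_limit_sequentially[of "- 1"]
    by (intro tendsto_intros lim_const_over_n) simp
  ultimately have "eventually (\<lambda>n. c * (1 - (1 - 1 / real n) ^ n) + 2 / real n < 1) sequentially"
    by (intro order_tendstoD) auto
  moreover have "eventually (\<lambda>n. 1 / real n < 1 - \<delta>) sequentially"
    using assms by (intro order_tendstoD(2)[OF lim_const_over_n]) auto
  \<comment> \<open>The second condition gives l \<le> 1/n < 1 - \<delta>. The third keeps
    \<open>to_bad\<close> positive, since it would be 0 for a single arm.\<close>
  ultimately have "eventually (\<lambda>n. c * (1 - (1 - 1 / real n) ^ n) + 2 / real n < 1 \<and>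
      1 / real n < 1 - \<delta> \<and> 2 \<le> n) sequentially"
    using eventually_ge_at_top[of 2] by eventually_elim auto
  then obtain n where n: "c * (1 - (1 - 1 / real n) ^ n) + 2 / real n < 1"
      "1 / real n < 1 - \<delta>" "2 \<le> n"
    unfolding eventually_sequentially by blast
  define l where "l = 1 / real n ^ 3"
  let ?I = "identical_arms n l"
  have "real n ^ 1 \<le> real n ^ 3"
    using n(3) by (intro power_increasing) auto
  then have "l \<le> 1 / real n"
    using n(3) by (simp add: l_def frac_le)
  then have l: "0 < l" "l \<le> 1 - \<delta>" "l < 1"
    using n assms by (simp_all add: l_def)
  show ?thesis
  proof (intro exI[of _ ?I] conjI allI)
    show "feedback_mab \<delta> ?I"
      using n l by (intro feedback_mab_identical_arms)
    fix init
    have "(0::ereal) < ereal (1 / real n)" using n(3) by simp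
    then show pos: "0 < optimal_value ?I init"
      using optimal_value_identical_arms_ge[OF n(3) l(1,3), of init] by (rule less_le_trans)
    have "ereal (exp 1 / (exp 1 - 1) - \<eta>) * optimal_value ?I init \<le> ereal c * optimal_value ?I init"
      using pos by (intro ereal_mult_right_mono) (auto simp: c_def)
    also have "\<dots> \<le> ereal c * ereal (1 - (1 - 1 / real n) ^ n)"
      using optimal_value_identical_arms_le[OF n(3) l(1,3)] c
      by (intro ereal_mult_left_mono) auto
    also have "\<dots> \<le> ereal (1 - 2 / real n)"
      using n(1) by simp
    also have "\<dots> \<le> whittle_value ?I"
      unfolding l_def using n(3) by (rule whittle_value_slow_arms_ge)
    finally show "ereal (exp 1 / (exp 1 - 1) - \<eta>) * optimal_value ?I init \<le> whittle_value ?I" .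
  qed
qed

end
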